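(* Let $\tau,\sigma>0$ satisfy $\tau\sigma\|A\|^2<1$, let $T\ge 1$ be an integer, let $z^{0,0}\in E\times Y$, and let $(z^{n,0})_{n\ge 0}$ be the restart points generated by the exact restarted averaged PDHG scheme with stepsizes $\tau,\sigma$ and epoch length $T$. Put $d_0:=\operatorname{dist}(z^{0,0},Z^\star)$ and $$R_0:=\frac{1+\kappa_P}{1-e^{-1}}\,d_0 .$$ Suppose $d_0>0$ and that there are a point $\bar z\in Z^\star$ and constants $R>0$, $\xi>0$, $\alpha_\xi>0$ such that $$G_\xi(z;z^\star)\ge \alpha_\xi\operatorname{dist}^2(z,Z^\star)\qquad\text{for every } z\in (K\times Y)\cap B_R(\bar z)\text{ and every } z^\star\in Z^\star\cap B_R(\bar z),$$ and that $\overline B_{R_0}(z^{0,0})\subseteq B_R(\bar z)$. If $$T\ge\max\left\{\frac{2\lambda_+}{\xi},\ \frac{e^2\lambda_+}{\alpha_\xi}\right\},$$ then $$\operatorname{dist}(z^{n,0},Z^\star)\le e^{-n}d_0\qquad\text{for all } n\ge 0 .$$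
   Context: Problem. $E,Y$ are finite-dimensional Euclidean spaces, $A:E\to Y$ is linear with adjoint $A^*$, $Q:E\to E$ is self-adjoint positive semidefinite, $c\in E$, $b\in Y$, and $K\subseteq E$ is a nonempty closed convex cone with dual cone $K^*=\{s:\langle s,x\rangle\ge 0\ \forall x\in K\}$. The problem is $\min\{\tfrac12\langle x,Qx\rangle+\langle c,x\rangle: Ax=b,\ x\in K\}$, with saddle function $\mathcal L(x,y)=\tfrac12\langle x,Qx\rangle+\langle c,x\rangle+\langle y,b-Ax\rangle$ for $x\in K$, $y\in Y$. The KKT (saddle-point) set $Z^\star\subseteq E\times Y$ is the set of $(x,y)$ such that, with $s=Qx+c-A^*y$, one has $Ax=b$, $x\in K$, $s\in K^*$, $\langle x,s\rangle=0$. Standing assumption: $Z^\star\neq\emptyset$. Norms are Euclidean (product norm on $E\times Y$); $\operatorname{dist}$ is Euclidean distance; $B_r(z)$ and $\overline B_r(z)$ are the open and closed balls in $E\times Y$. Smoothed duality gap. For $z=(x,y)\in K\times Y$, $\widehat z=(\widehat x,\widehat y)\in K\times Y$, set $\mathcal Q(z,\widehat z)=\mathcal L(x,\widehat y)-\mathcal L(\widehat x,y)$. For $\xi>0$ and $\dot z=(\dot x,\dot y)\in E\times Y$, $$G_\xi(z;\dot z)=\sup_{\widehat x\in K,\ \widehat y\in Y}\Big\{\mathcal Q(z,\widehat z)-\tfrac{\xi}{2}\|\widehat x-\dot x\|^2-\tfrac{\xi}{2}\|\widehat y-\dot y\|^2\Big\}.$$ Exact scheme. Let $F(x)=\tfrac12\langle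 x,Qx\rangle+\langle c,x\rangle+\delta_K(x)$, $\delta_K$ the indicator function of $K$, and $\operatorname{prox}_{\tau F}(v)=\arg\min_u\{F(u)+\tfrac1{2\tau}\|u-v\|^2\}$. One PDHG step $\mathcal T(x,y)=(x^+,y^+)$ is $x^+=\operatorname{prox}_{\tau F}(x+\tau A^*y)$, $y^+=y+\sigma(b-A(2x^+-x))$. In epoch $n$, $z^{n,k+1}=\mathcal T(z^{n,k})$ for $k=0,\dots,T-1$, and the next epoch starts at the average $z^{n+1,0}=\frac1T\sum_{k=0}^{T-1}z^{n,k+1}$. Metric constants. $P=\begin{bmatrix}\tau^{-1}I&A^*\\ A&\sigma^{-1}I\end{bmatrix}$ on $E\times Y$ (positive definite when $\tau\sigma\|A\|^2<1$), $\lambda_-=\lambda_{\min}(P)$, $\lambda_+=\lambda_{\max}(P)$, $\kappa_P=\sqrt{\lambda_+/\lambda_-}$. *)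

theory Defs
  imports "HOL-Analysis.Analysis"
begin

text \<open>
  Throughout, the data of the conic quadratic program
  \<open>min 1/2 \<langle>x, Q x\<rangle> + \<langle>c, x\<rangle>\<close> subject to \<open>A x = b\<close>, \<open>x \<in> K\<close>
  are passed as explicit arguments.  The adjoint of \<open>A\<close> is the library's \<open>adjoint A\<close>, and
  norm, distance and balls on the product type are the Euclidean ones.
\<close>

definition dual_cone :: "'e::real_inner set \<Rightarrow> 'e set" where
  "dual_cone K = {s. \<forall>x\<in>K. 0 \<le> s \<bullet> x}"

definition objective :: "('e::euclidean_space \<Rightarrow> 'e) \<Rightarrow> 'e \<Rightarrow> 'e \<Rightarrow> real" where
  "objective Q c x = 1/2 * (x \<bullet> Q x) + c \<bullet> x"

definition saddle ::
  "('e::euclidean_space \<Rightarrow> 'y::euclidean_space) \<Rightarrow> 'y \<Rightarrow> ('e \<Rightarrow> 'e) \<Rightarrow> 'e \<Rightarrow> 'e \<Rightarrow> 'y \<Rightarrow> real" where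
  "saddle A b Q c x y = objective Q c x + y \<bullet> (b - A x)"

definition KKT_set ::
  "('e::euclidean_space \<Rightarrow> 'y::euclidean_space) \<Rightarrow> 'y \<Rightarrow> ('e \<Rightarrow> 'e) \<Rightarrow> 'e \<Rightarrow> 'e set \<Rightarrow> ('e \<times> 'y) set" where
  "KKT_set A b Q c K =
     {(x, y). let s = Q x + c - adjoint A y in A x = b \<and> x \<in> K \<and> s \<in> dual_cone K \<and> x \<bullet> s = 0}"

definition gap ::
  "('e::euclidean_space \<Rightarrow> 'y::euclidean_space) \<Rightarrow> 'y \<Rightarrow> ('e \<Rightarrow> 'e) \<Rightarrow> 'e \<Rightarrow> 'e \<times> 'y \<Rightarrow> 'e \<times> 'y \<Rightarrow> real" where
  "gap A b Q c z z' = saddle A b Q c (fst z) (snd z') - saddle A b Q c (fst z') (snd z)"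

text \<open>The supremum is taken in the extended reals, so no boundedness convention is involved.\<close>

definition smoothed_gap ::
  "('e::euclidean_space \<Rightarrow> 'y::euclidean_space) \<Rightarrow> 'y \<Rightarrow> ('e \<Rightarrow> 'e) \<Rightarrow> 'e \<Rightarrow> 'e set \<Rightarrow>
   real \<Rightarrow> 'e \<times> 'y \<Rightarrow> 'e \<times> 'y \<Rightarrow> ereal" where
  "smoothed_gap A b Q c K \<xi> z zd =
     (SUP z'\<in>K \<times> UNIV.
        ereal (gap A b Q c z z' - \<xi>/2 * (norm (fst z' - fst zd))\<^sup>2 - \<xi>/2 * (norm (snd z' - snd zd))\<^sup>2))"

definition convex_indicator :: "'e set \<Rightarrow> 'e \<Rightarrow> ereal" where
  "convex_indicator K x = (if x \<in> K then 0 else \<infinity>)"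

definition primal_fun :: "('e::euclidean_space \<Rightarrow> 'e) \<Rightarrow> 'e \<Rightarrow> 'e set \<Rightarrow> 'e \<Rightarrow> ereal" where
  "primal_fun Q c K x = ereal (objective Q c x) + convex_indicator K x"

text \<open>
  \<open>arg_min\<close> picks some minimizer; for \<open>F = primal_fun Q c K\<close> with \<open>Q\<close> linear, self-adjoint and
  positive semidefinite, \<open>K\<close> nonempty, closed and convex, and \<open>\<tau> > 0\<close>, there is exactly one.
\<close>

definition prox :: "real \<Rightarrow> ('e::real_normed_vector \<Rightarrow> ereal) \<Rightarrow> 'e \<Rightarrow> 'e" where
  "prox \<tau> F v = arg_min (\<lambda>u. F u + ereal (1 / (2 * \<tau>) * (norm (u - v))\<^sup>2)) (\<lambda>_. True)"

definition pdhg_step ::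
  "('e::euclidean_space \<Rightarrow> 'y::euclidean_space) \<Rightarrow> 'y \<Rightarrow> ('e \<Rightarrow> 'e) \<Rightarrow> 'e \<Rightarrow> 'e set \<Rightarrow>
   real \<Rightarrow> real \<Rightarrow> 'e \<times> 'y \<Rightarrow> 'e \<times> 'y" where
  "pdhg_step A b Q c K \<tau> \<sigma> = (\<lambda>(x, y).
     let x' = prox \<tau> (primal_fun Q c K) (x + \<tau> *\<^sub>R adjoint A y)
     in (x', y + \<sigma> *\<^sub>R (b - A (2 *\<^sub>R x' - x))))"

text \<open>
  \<open>restart_point \<dots> z0 n\<close> is \<open>z\<^sup>n\<^sup>,\<^sup>0\<close>; inside an epoch, the \<open>k\<close>-th iterate is the \<open>k\<close>-fold
  application of the step to the restart point.
\<close>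

primrec restart_point ::
  "('e::euclidean_space \<Rightarrow> 'y::euclidean_space) \<Rightarrow> 'y \<Rightarrow> ('e \<Rightarrow> 'e) \<Rightarrow> 'e \<Rightarrow> 'e set \<Rightarrow>
   real \<Rightarrow> real \<Rightarrow> nat \<Rightarrow> 'e \<times> 'y \<Rightarrow> nat \<Rightarrow> 'e \<times> 'y" where
  "restart_point A b Q c K \<tau> \<sigma> T z0 0 = z0"
| "restart_point A b Q c K \<tau> \<sigma> T z0 (Suc n) =
     (1 / real T) *\<^sub>R
       (\<Sum>k<T. (pdhg_step A b Q c K \<tau> \<sigma> ^^ (k + 1)) (restart_point A b Q c K \<tau> \<sigma> T z0 n))"

definition pdhg_metric ::
  "('e::euclidean_space \<Rightarrow> 'y::euclidean_space) \<Rightarrow> real \<Rightarrow> real \<Rightarrow> 'e \<times> 'y \<Rightarrow> 'e \<times> 'y" where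
  "pdhg_metric A \<tau> \<sigma> = (\<lambda>(x, y). ((1 / \<tau>) *\<^sub>R x + adjoint A y, A x + (1 / \<sigma>) *\<^sub>R y))"

definition is_eigenvalue :: "('a::real_vector \<Rightarrow> 'a) \<Rightarrow> real \<Rightarrow> bool" where
  "is_eigenvalue f l \<longleftrightarrow> (\<exists>v. v \<noteq> 0 \<and> f v = l *\<^sub>R v)"

text \<open>For a self-adjoint operator on a Euclidean space both extremal eigenvalues exist.\<close>

definition min_eigenvalue :: "('a::real_vector \<Rightarrow> 'a) \<Rightarrow> real" where
  "min_eigenvalue f = (LEAST l. is_eigenvalue f l)"

definition max_eigenvalue :: "('a::real_vector \<Rightarrow> 'a) \<Rightarrow> real" where
  "max_eigenvalue f = (GREATEST l. is_eigenvalue f l)"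

end

theory Submission
  imports Defs
begin

text \<open>
  The optimality condition of the proximal step gives, for every \<open>w \<in> K \<times> Y\<close>,
  \<open>\<Q>(z\<^sup>+, w) \<le> \<langle>P (z\<^sup>+ - z), w - z\<^sup>+\<rangle> \<le> 1/2 (\<parallel>w - z\<parallel>\<^sub>P\<^sup>2 - \<parallel>w - z\<^sup>+\<parallel>\<^sub>P\<^sup>2)\<close>.
  Telescoping over an epoch and convexity of \<open>\<Q>(\<sqdot>, w)\<close> bound the gap at the average by
  \<open>\<parallel>w - z\<parallel>\<^sub>P\<^sup>2 / (2 T)\<close>; for \<open>T \<ge> 2 \<lambda>\<^sub>+ / \<xi>\<close> the proximal terms of the smoothed gap
  centred at the projection \<open>z\<^sup>*\<close> of \<open>z\<close> onto the KKT set absorb the part depending on \<open>w\<close>,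
  leaving \<open>\<lambda>\<^sub>+ / T \<cdot> dist\<^sup>2(z, Z)\<close>.  With the growth condition and \<open>T \<ge> e\<^sup>2 \<lambda>\<^sub>+ / \<alpha>\<close>,
  each epoch contracts the distance by \<open>1/e\<close>.  Since the gap is nonnegative at KKT points, the steps
  are Fejer monotone in the \<open>P\<close>-norm, so an epoch moves \<open>z\<close> by at most \<open>(1 + \<kappa>) dist(z, Z)\<close>.
  The resulting geometric series, whose sum is \<open>R0\<close>, keeps the restart points and their projections
  in the ball where growth holds.
\<close>

section \<open>First-order conditions, averages and extremal eigenvalues\<close>

text \<open>For small \<open>t\<close> the linear term dominates. Both first-order conditions below
  rest on this: at a Rayleigh minimiser and at a proximal point.\<close>

lemma linear_coeff_nonneg:
  fixes a q :: real
  assumes "\<And>t. 0 < t \<Longrightarrow> t \<le> 1 \<Longrightarrow> 0 \<le> t * a + t\<^sup>2 * q"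
  shows "0 \<le> a"
proof (rule ccontr)
  assume "\<not> 0 \<le> a"
  \<comment> \<open>Chosen so that \<open>t * q\<close> is at most \<open>- a / 2\<close>; the
    \<open>+ 1\<close> covers \<open>q = 0\<close>.\<close>
  define t where "t = min 1 (- a / (2 * (\<bar>q\<bar> + 1)))"
  have t: "0 < t" "t \<le> 1"
    using \<open>\<not> 0 \<le> a\<close> by (auto simp: t_def divide_simps)
  have "t * q \<le> t * (\<bar>q\<bar> + 1)"
    using t by (intro mult_left_mono) auto
  also have "\<dots> \<le> (- a / (2 * (\<bar>q\<bar> + 1))) * (\<bar>q\<bar> + 1)"
    by (intro mult_right_mono) (auto simp: t_def)
  also have "\<dots> = - a / 2"
    by (simp add: field_simps)
  finally have "a + t * q < 0"
    using \<open>\<not> 0 \<le> a\<close> by linarith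
  then have "t * (a + t * q) < 0"
    using t by (simp add: mult_pos_neg)
  moreover have "0 \<le> t * (a + t * q)"
    using assms[OF t] by (simp add: algebra_simps power2_eq_square)
  ultimately show False by linarith
qed

lemma quadratic_form_add:
  fixes B :: "'a::real_inner \<Rightarrow> 'a"
  assumes "linear B" "\<And>x y. x \<bullet> B y = B x \<bullet> y"
  shows "(x + h) \<bullet> B (x + h) = x \<bullet> B x + 2 * (B x \<bullet> h) + h \<bullet> B h"
  using assms(2)[of h x] assms(2)[of x h]
  by (simp add: linear_add[OF assms(1)] inner_simps inner_commute)

text \<open>Jensen's inequality with equal weights: one affine minorant touching \<open>f\<close> at
  the mean is enough, since its linear part sums to zero over the points \<open>u k\<close>.\<close>

lemma subgradient_mean_le:
  fixes f :: "'a::real_inner \<Rightarrow> real"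
  assumes "0 < T" and m: "m = (1 / real T) *\<^sub>R (\<Sum>k<T. u k)"
    and sub: "\<And>w. f m + g \<bullet> (w - m) \<le> f w"
  shows "real T * f m \<le> (\<Sum>k<T. f (u k))"
proof -
  have "(\<Sum>k<T. f m + g \<bullet> (u k - m)) \<le> (\<Sum>k<T. f (u k))"
    by (intro sum_mono sub)
  moreover have "(\<Sum>k<T. g \<bullet> (u k - m)) = 0"
    using \<open>0 < T\<close> by (simp add: m inner_simps sum_subtractf flip: inner_sum_right)
  ultimately show ?thesis
    by (simp add: sum.distrib)
qed

text \<open>
  A minimiser \<open>v\<close> of the quadratic form on the unit sphere is an eigenvector: for the minimum \<open>m\<close>,
  the operator \<open>B - m I\<close> is positive semidefinite and its form vanishes at \<open>v\<close>, so its gradient does too.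
\<close>

lemma rayleigh_min:
  fixes B :: "'a::euclidean_space \<Rightarrow> 'a"
  assumes B: "linear B" and sym: "\<And>x y. x \<bullet> B y = B x \<bullet> y"
  shows "is_eigenvalue B (min_eigenvalue B)" "min_eigenvalue B * (norm x)\<^sup>2 \<le> x \<bullet> B x"
proof -
  have cont: "continuous_on (sphere 0 1) (\<lambda>x. x \<bullet> B x)"
    by (intro continuous_intros linear_continuous_on linear_conv_bounded_linear[THEN iffD1] B)
  have "sphere (0::'a) 1 \<noteq> {}"
    by simp
  then obtain v where v: "norm v = 1" and vmin: "\<And>w. norm w = 1 \<Longrightarrow> v \<bullet> B v \<le> w \<bullet> B w"
    using continuous_attains_inf[OF compact_sphere _ cont] by (auto simp: dist_norm)
  define m where "m = v \<bullet> B v"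
  define C where "C = (\<lambda>x. B x - m *\<^sub>R x)"
  have C: "linear C"
    unfolding C_def by (intro linear_compose_sub B linear_compose_scale_right linear_ident)
  have Csym: "x \<bullet> C y = C x \<bullet> y" for x y
    by (simp add: C_def inner_simps sym)
  have bound: "m * (norm x)\<^sup>2 \<le> x \<bullet> B x" for x
  proof (cases "x = 0")
    case False
    have "m \<le> sgn x \<bullet> B (sgn x)"
      unfolding m_def using False by (intro vmin) (simp add: norm_sgn)
    also have "\<dots> = (x \<bullet> B x) / (norm x)\<^sup>2"
      by (simp add: sgn_div_norm linear_scale[OF B] power2_eq_square field_simps)
    finally show ?thesis
      using False by (simp add: field_simps)
  qed (simp add: linear_0[OF B])
  have Cpsd: "0 \<le> x \<bullet> C x" for x
    using bound[of x] by (simp add: C_def inner_simps dot_square_norm)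
  have Cv: "v \<bullet> C v = 0"
    using v by (simp add: C_def inner_simps m_def dot_square_norm)
  \<comment> \<open>The form stays nonnegative when \<open>v\<close> is moved against its gradient,
    while the linear coefficient of that move is \<open>-2\<close> times the squared norm of
    \<open>C v\<close>.\<close>
  have "0 \<le> 2 * (C v \<bullet> (- C v))"
  proof (rule linear_coeff_nonneg)
    fix t :: real
    show "0 \<le> t * (2 * (C v \<bullet> (- C v))) + t\<^sup>2 * (C v \<bullet> C (C v))"
      using Cpsd[of "v + t *\<^sub>R (- C v)"] Cv quadratic_form_add[OF C Csym, of v "t *\<^sub>R (- C v)"]
      by (simp add: linear_scale[OF C] linear_neg[OF C] power2_eq_square algebra_simps)
  qed
  then have "C v = 0"
    using inner_ge_zero[of "C v"] inner_eq_zero_iff[of "C v"] by simp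
  then have ev: "is_eigenvalue B m"
    using v unfolding is_eigenvalue_def C_def by (intro exI[of _ v]) auto
  have "m \<le> l" if l: "is_eigenvalue B l" for l
  proof -
    obtain w where "w \<noteq> 0" "B w = l *\<^sub>R w"
      using l by (auto simp: is_eigenvalue_def)
    with bound[of w] show ?thesis
      by (simp add: dot_square_norm)
  qed
  then have "min_eigenvalue B = m"
    unfolding min_eigenvalue_def using ev by (intro Least_equality)
  with ev bound show "is_eigenvalue B (min_eigenvalue B)" "min_eigenvalue B * (norm x)\<^sup>2 \<le> x \<bullet> B x"
    by auto
qed

text \<open>Negation swaps the two ends of the spectrum, so \<open>rayleigh_min\<close> is applied
  to \<open>- B\<close>.\<close>

lemma rayleigh_max:
  fixes B :: "'a::euclidean_space \<Rightarrow> 'a"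
  assumes B: "linear B" and sym: "\<And>x y. x \<bullet> B y = B x \<bullet> y"
  shows "x \<bullet> B x \<le> max_eigenvalue B * (norm x)\<^sup>2"
proof -
  define m where "m = min_eigenvalue (\<lambda>x. - B x)"
  have neg: "linear (\<lambda>x. - B x)" "x \<bullet> - B y = - B x \<bullet> y" for x y
    using B sym by (auto intro: linear_compose_neg)
  have iff: "is_eigenvalue (\<lambda>x. - B x) l \<longleftrightarrow> is_eigenvalue B (- l)" for l
    unfolding is_eigenvalue_def by (metis minus_minus scaleR_minus_left)
  have ev: "is_eigenvalue B (- m)"
    using rayleigh_min(1)[OF neg] by (simp add: iff m_def)
  have bound: "x \<bullet> B x \<le> - m * (norm x)\<^sup>2" for x
    using rayleigh_min(2)[OF neg, of x] by (simp add: m_def)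
  have "l \<le> - m" if l: "is_eigenvalue B l" for l
  proof -
    obtain w where "w \<noteq> 0" "B w = l *\<^sub>R w"
      using l by (auto simp: is_eigenvalue_def)
    with bound[of w] show ?thesis
      by (simp add: dot_square_norm flip: minus_mult_left)
         (metis minus_mult_left mult_le_cancel_right_pos zero_less_norm_iff zero_less_power)
  qed
  then have "max_eigenvalue B = - m"
    unfolding max_eigenvalue_def using ev by (intro Greatest_equality)
  with bound show ?thesis by simp
qed

section \<open>The problem data and the metric \<open>P\<close>\<close>

locale pdhg =
  fixes A :: "'e::euclidean_space \<Rightarrow> 'y::euclidean_space" and b :: 'y
    and Q :: "'e \<Rightarrow> 'e" and c :: 'e and K :: "'e set" and \<tau> \<sigma> :: real
  assumes A: "linear A"
    and Q: "linear Q" "adjoint Q = Q" "\<And>x. 0 \<le> x \<bullet> Q x"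
    and K: "convex_cone K" "closed K"
    and steps: "0 < \<tau>" "0 < \<sigma>" "\<tau> * \<sigma> * (onorm A)\<^sup>2 < 1"
begin

abbreviation "P \<equiv> pdhg_metric A \<tau> \<sigma>"
abbreviation "step \<equiv> pdhg_step A b Q c K \<tau> \<sigma>"
abbreviation "obj \<equiv> objective Q c"
abbreviation "Z \<equiv> KKT_set A b Q c K"

definition normP2 :: "'e \<times> 'y \<Rightarrow> real" where "normP2 z = z \<bullet> P z"

lemma Q_sym: "x \<bullet> Q y = Q x \<bullet> y"
  using adjoint_works[OF Q(1), of x y] Q(2) by simp

lemma adjoint_A: "x \<bullet> adjoint A y = A x \<bullet> y" "adjoint A y \<bullet> x = A x \<bullet> y"
  using adjoint_works[OF A, of x y] by (simp_all add: inner_commute)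

lemma P_linear: "linear P"
  unfolding pdhg_metric_def
  by (rule linearI)
     (auto simp: linear_add[OF A] linear_scale[OF A] linear_add[OF adjoint_linear[OF A]]
        linear_scale[OF adjoint_linear[OF A]] algebra_simps)

lemma P_sym: "z \<bullet> P w = P z \<bullet> w"
  by (cases z; cases w)
     (simp add: pdhg_metric_def inner_simps adjoint_A, simp add: inner_commute)

text \<open>Cauchy-Schwarz and the operator norm bound \<open>normP2 z\<close>, scaled by
  \<open>\<tau> * \<sigma>\<close>, below by a quadratic form in \<open>norm x\<close> and
  \<open>norm y\<close>, which the step size condition makes positive.\<close>

lemma P_pos:
  assumes "z \<noteq> 0"
  shows "0 < normP2 z"
proof -
  obtain x y where z: "z = (x, y)" by fastforce
  define a where "a = onorm A"
  have Ax: "norm (A x) \<le> a * norm x"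
    unfolding a_def by (rule onorm) (simp add: A linear_conv_bounded_linear[symmetric])
  have "\<bar>A x \<bullet> y\<bar> \<le> norm (A x) * norm y"
    by (rule Cauchy_Schwarz_ineq2)
  also have "\<dots> \<le> a * norm x * norm y"
    using Ax by (intro mult_right_mono) auto
  finally have "- (a * norm x * norm y) \<le> A x \<bullet> y"
    by linarith
  then have "- (2 * (\<tau> * \<sigma>) * (a * norm x * norm y)) \<le> 2 * (\<tau> * \<sigma>) * (A x \<bullet> y)"
    using mult_left_mono[of "- (a * norm x * norm y)" "A x \<bullet> y" "2 * (\<tau> * \<sigma>)"] steps by simp
  moreover have "\<tau> * \<sigma> * normP2 z = \<sigma> * (norm x)\<^sup>2 + 2 * (\<tau> * \<sigma>) * (A x \<bullet> y) + \<tau> * (norm y)\<^sup>2"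
    using steps by (simp add: normP2_def z pdhg_metric_def inner_simps adjoint_A dot_square_norm
        inner_commute[of y] field_simps)
  \<comment> \<open>The square is completed in \<open>norm y\<close>, so that the factor
    \<open>1 - \<tau> * \<sigma> * a\<^sup>2\<close> from the step size condition appears.\<close>
  moreover have "\<sigma> * (norm x)\<^sup>2 - 2 * (\<tau> * \<sigma>) * (a * norm x * norm y) + \<tau> * (norm y)\<^sup>2 =
      \<tau> * (norm y - \<sigma> * a * norm x)\<^sup>2 + \<sigma> * (1 - \<tau> * \<sigma> * a\<^sup>2) * (norm x)\<^sup>2"
    by (simp add: power2_eq_square algebra_simps)
  moreover have "0 < \<tau> * (norm y - \<sigma> * a * norm x)\<^sup>2 + \<sigma> * (1 - \<tau> * \<sigma> * a\<^sup>2) * (norm x)\<^sup>2"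
  proof (cases "x = 0")
    case True
    then show ?thesis using assms steps by (simp add: z zero_prod_def)
  next
    case False
    then have "0 < \<sigma> * (1 - \<tau> * \<sigma> * a\<^sup>2) * (norm x)\<^sup>2"
      using steps by (simp add: a_def)
    then show ?thesis
      using steps by (simp add: add_nonneg_pos)
  qed
  ultimately have "0 < \<tau> * \<sigma> * normP2 z" by linarith
  then show ?thesis
    using mult_pos_pos[OF steps(1,2)] by (rule zero_less_mult_pos)
qed

lemma P_nonneg: "0 \<le> normP2 z"
  using P_pos[of z] by (cases "z = 0") (auto simp: normP2_def)

lemma objective_add: "obj (x + h) = obj x + (Q x + c) \<bullet> h + 1/2 * (h \<bullet> Q h)"
  using quadratic_form_add[OF Q(1) Q_sym, of x h]
  by (simp add: objective_def inner_simps algebra_simps)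

lemma objective_ge_tangent: "obj x + (Q x + c) \<bullet> (u - x) \<le> obj u"
  using objective_add[of x "u - x"] Q(3)[of "u - x"] by simp

lemma min_eigenvalue_P_pos: "0 < min_eigenvalue P"
proof -
  obtain v where "v \<noteq> 0" "P v = min_eigenvalue P *\<^sub>R v"
    using rayleigh_min(1)[OF P_linear P_sym] by (auto simp: is_eigenvalue_def)
  with P_pos[of v] show ?thesis
    by (simp add: normP2_def dot_square_norm zero_less_mult_iff)
qed

lemma normP2_bounds:
  "min_eigenvalue P * (norm z)\<^sup>2 \<le> normP2 z" "normP2 z \<le> max_eigenvalue P * (norm z)\<^sup>2"
  using rayleigh_min(2)[OF P_linear P_sym] rayleigh_max[OF P_linear P_sym] by (auto simp: normP2_def)

lemma max_eigenvalue_P_pos: "0 < max_eigenvalue P"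
proof -
  obtain v :: "'e \<times> 'y" where "v \<noteq> 0"
    using rayleigh_min(1)[OF P_linear P_sym] unfolding is_eigenvalue_def by blast
  then have "0 < max_eigenvalue P * (norm v)\<^sup>2"
    using P_pos[of v] normP2_bounds(2)[of v] by linarith
  then show ?thesis
    by (simp add: zero_less_mult_iff)
qed

section \<open>The proximal step and its variational inequality\<close>

text \<open>Since \<open>prox\<close> is a choice made by \<open>arg_min\<close>, a minimiser must
  first be shown to exist: coercivity reduces the search to a compact piece of \<open>K\<close>. The
  inequality is then the first-order condition along segments in \<open>K\<close>.\<close>

lemma prox_variational:
  defines "p \<equiv> \<lambda>v. prox \<tau> (primal_fun Q c K) v"
  shows "p v \<in> K" "u \<in> K \<Longrightarrow> 0 \<le> (Q (p v) + c + (1 / \<tau>) *\<^sub>R (p v - v)) \<bullet> (u - p v)"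
proof -
  define g where "g = (\<lambda>u. obj u + 1 / (2 * \<tau>) * (norm (u - v))\<^sup>2)"
  define h where "h = (\<lambda>u. primal_fun Q c K u + ereal (1 / (2 * \<tau>) * (norm (u - v))\<^sup>2))"
  define G where "G = norm (Q v + c)"
  define D where "D = \<bar>g 0 - obj v\<bar>"
  \<comment> \<open>Beyond this radius the proximal term exceeds the possible linear decrease, of
    slope \<open>G\<close>, by more than \<open>D\<close>; the \<open>+ 1\<close> makes the distance
    \<open>r\<close> at least 1, so the estimate may be multiplied by \<open>r\<close>.\<close>
  define \<rho> where "\<rho> = 2 * \<tau> * (G + D) + 1"
  have "0 \<in> K" using K(1) by (rule convex_cone_contains_0)
  have h: "h u = (if u \<in> K then ereal (g u) else \<infinity>)" for u
    by (simp add: h_def g_def primal_fun_def convex_indicator_def)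
  have far: "g 0 < g u" if "\<rho> < norm (u - v)" for u
  proof -
    define r where "r = norm (u - v)"
    have r: "2 * \<tau> * (G + D) + 1 < r"
      using that by (simp add: r_def \<rho>_def)
    have GD: "0 \<le> G" "0 \<le> D"
      by (simp_all add: G_def D_def)
    then have "0 \<le> 2 * \<tau> * (G + D)"
      using steps by simp
    with r have "1 \<le> r" by linarith
    have "2 * \<tau> * (G + D) < r" using r by linarith
    then have "D < r / (2 * \<tau>) - G"
      using steps by (simp add: field_simps)
    also have "\<dots> \<le> r * (r / (2 * \<tau>) - G)"
      using mult_right_mono[OF \<open>1 \<le> r\<close>, of "r / (2 * \<tau>) - G"] calculation GD by simp
    finally have "D < r\<^sup>2 / (2 * \<tau>) - G * r"
      by (simp add: algebra_simps power2_eq_square)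
    moreover have "- (G * r) \<le> (Q v + c) \<bullet> (u - v)"
      using Cauchy_Schwarz_ineq2[of "Q v + c" "u - v"] by (simp add: G_def r_def)
    moreover have "obj v + (Q v + c) \<bullet> (u - v) \<le> obj u"
      by (rule objective_ge_tangent)
    ultimately show ?thesis
      by (simp add: D_def g_def r_def)
  qed
  have cont: "continuous_on (cball v \<rho> \<inter> K) g"
    unfolding g_def objective_def
    by (intro continuous_intros linear_continuous_on linear_conv_bounded_linear[THEN iffD1] Q(1))
  \<comment> \<open>Otherwise \<open>far\<close> at the origin would give
    \<open>g 0 < g 0\<close>.\<close>
  have "0 \<in> cball v \<rho> \<inter> K"
    using far[of 0] \<open>0 \<in> K\<close> by (force simp: dist_norm)
  moreover have "compact (cball v \<rho> \<inter> K)"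
    using K(2) by (intro compact_Int_closed) auto
  ultimately obtain x where x: "x \<in> cball v \<rho> \<inter> K" and xmin: "\<And>w. w \<in> cball v \<rho> \<inter> K \<Longrightarrow> g x \<le> g w"
    using continuous_attains_inf[OF _ _ cont] by blast
  have "g x \<le> g w" if "w \<in> K" for w
  proof (cases "w \<in> cball v \<rho>")
    case False
    then have "g 0 < g w"
      by (intro far) (simp add: dist_norm norm_minus_commute)
    with xmin[OF \<open>0 \<in> cball v \<rho> \<inter> K\<close>] show ?thesis by linarith
  qed (use that xmin in auto)
  then have "is_arg_min h (\<lambda>_. True) x"
    using x by (auto simp: is_arg_min_def h not_less)
  then have "is_arg_min h (\<lambda>_. True) (p v)"
    unfolding p_def prox_def h_def[symmetric] arg_min_def by (rule someI)
  then have hmin: "h (p v) \<le> h w" for w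
    by (auto simp: is_arg_min_def not_less)
  show pK: "p v \<in> K"
    using hmin[of 0] \<open>0 \<in> K\<close> by (auto simp: h split: if_splits)
  have gmin: "g (p v) \<le> g w" if "w \<in> K" for w
    using hmin[of w] that pK by (simp add: h)
  assume "u \<in> K"
  define d where "d = u - p v"
  show "0 \<le> (Q (p v) + c + (1 / \<tau>) *\<^sub>R (p v - v)) \<bullet> (u - p v)"
  proof (rule linear_coeff_nonneg)
    fix t :: real
    assume t: "0 < t" "t \<le> 1"
    have "p v + t *\<^sub>R d = (1 - t) *\<^sub>R p v + t *\<^sub>R u"
      by (simp add: d_def algebra_simps)
    also have "\<dots> \<in> K"
      using K(1) pK \<open>u \<in> K\<close> t by (intro convexD) (auto simp: convex_cone_def)
    finally have "g (p v) \<le> g (p v + t *\<^sub>R d)"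
      by (rule gmin)
    also have "g (p v + t *\<^sub>R d) = g (p v) + (t * ((Q (p v) + c + (1 / \<tau>) *\<^sub>R (p v - v)) \<bullet> d)
        + t\<^sup>2 * (1/2 * (d \<bullet> Q d) + 1 / (2 * \<tau>) * (norm d)\<^sup>2))"
    proof -
      have "(norm (p v + t *\<^sub>R d - v))\<^sup>2 = (norm (p v - v))\<^sup>2 + 2 * t * ((p v - v) \<bullet> d) + t\<^sup>2 * (norm d)\<^sup>2"
        unfolding power2_norm_eq_inner
        by (simp add: inner_simps inner_commute algebra_simps power2_eq_square)
      note sq = this
      show ?thesis
        unfolding g_def sq objective_add using steps
        by (simp add: linear_scale[OF Q(1)] inner_simps power2_eq_square field_simps)
    qed
    finally show "0 \<le> t * ((Q (p v) + c + (1 / \<tau>) *\<^sub>R (p v - v)) \<bullet> (u - p v))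
        + t\<^sup>2 * (1/2 * (d \<bullet> Q d) + 1 / (2 * \<tau>) * (norm d)\<^sup>2)"
      by (simp add: d_def)
  qed
qed

lemma step_in_K: "fst (step z) \<in> K"
  by (cases z) (simp add: pdhg_step_def Let_def prox_variational)

text \<open>The proximal inequality is added to the tangent bound for \<open>obj\<close>; together
  with the dual update, all cross terms collect into the metric \<open>P\<close>.\<close>

lemma gap_step_le:
  assumes "fst w \<in> K"
  shows "gap A b Q c (step z) w \<le> P (step z - z) \<bullet> (w - step z)"
proof -
  obtain x y u v where z: "z = (x, y)" and w: "w = (u, v)" by fastforce
  define x' where "x' = prox \<tau> (primal_fun Q c K) (x + \<tau> *\<^sub>R adjoint A y)"
  define y' where "y' = y + \<sigma> *\<^sub>R (b - A (2 *\<^sub>R x' - x))"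
  have s: "step z = (x', y')"
    by (simp add: z pdhg_step_def Let_def x'_def y'_def)
  have "0 \<le> (Q x' + c + (1 / \<tau>) *\<^sub>R (x' - (x + \<tau> *\<^sub>R adjoint A y))) \<bullet> (u - x')"
    unfolding x'_def using assms w by (intro prox_variational) auto
  also have "(1 / \<tau>) *\<^sub>R (x' - (x + \<tau> *\<^sub>R adjoint A y)) = (1 / \<tau>) *\<^sub>R (x' - x) - adjoint A y"
    using steps by (simp add: algebra_simps)
  finally have "0 \<le> (Q x' + c) \<bullet> (u - x') + ((1 / \<tau>) *\<^sub>R (x' - x)) \<bullet> (u - x') - A (u - x') \<bullet> y"
    by (simp add: inner_diff_left inner_add_left adjoint_A)
  moreover have "obj x' + (Q x' + c) \<bullet> (u - x') \<le> obj u"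
    by (rule objective_ge_tangent)
  \<comment> \<open>The extrapolation \<open>2 *\<^sub>R x' - x\<close> in the dual update is what
    turns the second component of \<open>P (step z - z)\<close> into the residual at
    \<open>x'\<close>.\<close>
  moreover have "A (x' - x) + (1 / \<sigma>) *\<^sub>R (y' - y) = b - A x'"
    using steps by (simp add: y'_def linear_diff[OF A] linear_add[OF A] scaleR_2)
  then have "P (step z - z) = ((1 / \<tau>) *\<^sub>R (x' - x) + adjoint A (y' - y), b - A x')"
    unfolding s by (simp add: z pdhg_metric_def)
  then have "P (step z - z) \<bullet> (w - step z) =
      ((1 / \<tau>) *\<^sub>R (x' - x)) \<bullet> (u - x') + A (u - x') \<bullet> (y' - y) + (b - A x') \<bullet> (v - y')"
    by (simp add: s w inner_add_left adjoint_A)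
  moreover have "gap A b Q c (step z) w = obj x' - obj u + (b - A x') \<bullet> (v - y') + A (u - x') \<bullet> y'"
    by (simp add: s w gap_def saddle_def linear_diff[OF A] inner_simps inner_commute)
  ultimately show ?thesis
    by (simp add: inner_diff_right)
qed

section \<open>Energy estimates for the gap and convexity\<close>

text \<open>Three-point identity: the squared \<open>P\<close>-norm of \<open>w - z\<close> is
  expanded around \<open>step z\<close>, and the nonnegative term \<open>normP2 (step z - z)\<close>
  is dropped.\<close>

lemma gap_step_le_normP2:
  assumes "fst w \<in> K"
  shows "2 * gap A b Q c (step z) w \<le> normP2 (w - z) - normP2 (w - step z)"
proof -
  have "normP2 (w - z) = normP2 (step z - z) + 2 * (P (step z - z) \<bullet> (w - step z)) + normP2 (w - step z)"
    using quadratic_form_add[OF P_linear P_sym, of "step z - z" "w - step z"] by (simp add: normP2_def)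
  with gap_step_le[OF assms, of z] P_nonneg[of "step z - z"] show ?thesis by linarith
qed

lemma sum_gap_le:
  assumes "fst w \<in> K"
  shows "2 * (\<Sum>k<n. gap A b Q c ((step ^^ (k + 1)) z) w) \<le> normP2 (w - z) - normP2 (w - (step ^^ n) z)"
proof (induction n)
  case (Suc n)
  with gap_step_le_normP2[OF assms, of "(step ^^ n) z"] show ?case by simp
qed simp

text \<open>Complementarity turns dual feasibility of \<open>s\<close> into a variational inequality
  at \<open>u\<close>, and \<open>A u = b\<close> removes the multiplier of \<open>z\<close> from
  the gap.\<close>

lemma gap_nonneg:
  assumes "w \<in> Z" "fst z \<in> K"
  shows "0 \<le> gap A b Q c z w"
proof -
  obtain x y u v where z: "z = (x, y)" and w: "w = (u, v)" by fastforce
  define s where "s = Q u + c - adjoint A v"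
  have "A u = b" "0 \<le> s \<bullet> x" "u \<bullet> s = 0"
    using assms by (auto simp: KKT_set_def dual_cone_def Let_def z w s_def)
  then have "0 \<le> s \<bullet> (x - u)"
    by (simp add: inner_diff_right inner_commute)
  then have "0 \<le> (Q u + c) \<bullet> (x - u) - A (x - u) \<bullet> v"
    by (simp add: s_def inner_diff_left adjoint_A)
  moreover have "obj u + (Q u + c) \<bullet> (x - u) \<le> obj x"
    by (rule objective_ge_tangent)
  ultimately show ?thesis
    using \<open>A u = b\<close>
    by (simp add: z w gap_def saddle_def linear_diff[OF A] inner_simps inner_commute)
qed

lemma gap_mean_le:
  assumes "0 < T" and m: "m = (1 / real T) *\<^sub>R (\<Sum>k<T. u k)"
  shows "real T * gap A b Q c m w \<le> (\<Sum>k<T. gap A b Q c (u k) w)"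
proof (rule subgradient_mean_le[OF assms])
  fix z
  \<comment> \<open>The pair is the gradient at \<open>m\<close> of the gap in its first argument,
    which is convex in the primal and affine in the dual variable.\<close>
  show "gap A b Q c m w + (Q (fst m) + c - adjoint A (snd w), A (fst w) - b) \<bullet> (z - m) \<le> gap A b Q c z w"
    using objective_ge_tangent[of "fst m" "fst z"]
    by (cases z; cases m; cases w)
       (simp add: gap_def saddle_def linear_diff[OF A] inner_simps adjoint_A inner_commute)
qed

lemma normP2_mean_le:
  assumes "0 < T" and m: "m = (1 / real T) *\<^sub>R (\<Sum>k<T. u k)"
  shows "real T * normP2 (w - m) \<le> (\<Sum>k<T. normP2 (w - u k))"
proof (rule subgradient_mean_le[OF assms])
  fix z
  show "normP2 (w - m) + (- 2 *\<^sub>R P (w - m)) \<bullet> (z - m) \<le> normP2 (w - z)"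
    using quadratic_form_add[OF P_linear P_sym, of "w - m" "m - z"] P_nonneg[of "m - z"]
    by (simp add: normP2_def inner_diff_right)
qed

text \<open>Closedness makes \<open>infdist\<close> attained, which supplies the nearest KKT point
  in each epoch. Membership in the dual cone is split into one closed condition per element of
  \<open>K\<close>.\<close>

lemma closed_KKT: "closed Z"
proof -
  have eq: "Z = {z. A (fst z) = b} \<inter> {z. fst z \<in> K} \<inter>
      (\<Inter>x\<in>K. {z. 0 \<le> (Q (fst z) + c - adjoint A (snd z)) \<bullet> x}) \<inter>
      {z. fst z \<bullet> (Q (fst z) + c - adjoint A (snd z)) = 0}"
    by (auto simp: KKT_set_def dual_cone_def Let_def)
  have cont: "continuous_on UNIV (\<lambda>z::'e \<times> 'y. A (fst z))" "continuous_on UNIV (\<lambda>z::'e \<times> 'y. Q (fst z))"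
    "continuous_on UNIV (\<lambda>z::'e \<times> 'y. adjoint A (snd z))"
    by (rule linear_continuous_on_compose[OF continuous_on_fst[OF continuous_on_id] A]
        linear_continuous_on_compose[OF continuous_on_fst[OF continuous_on_id] Q(1)]
        linear_continuous_on_compose[OF continuous_on_snd[OF continuous_on_id] adjoint_linear[OF A]])+
  have "closed {z :: 'e \<times> 'y. fst z \<in> K}"
    using closed_vimage_fst[OF K(2)] by (simp add: vimage_def)
  then show ?thesis
    unfolding eq
    by (intro closed_Int closed_INT ballI closed_Collect_eq closed_Collect_le cont continuous_intros)
qed

section \<open>Averages over one epoch\<close>

definition epoch :: "nat \<Rightarrow> 'e \<times> 'y \<Rightarrow> 'e \<times> 'y" where
  "epoch T z = (1 / real T) *\<^sub>R (\<Sum>k<T. (step ^^ (k + 1)) z)"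

text \<open>The index \<open>k + 1\<close> leaves the starting point out of the average, so each
  averaged point is the output of a step, even when \<open>z\<close> itself is outside
  \<open>K\<close>.\<close>

lemma epoch_in_K:
  assumes "0 < T"
  shows "fst (epoch T z) \<in> K"
proof -
  have "(\<Sum>k<T. (1 / real T) *\<^sub>R fst ((step ^^ (k + 1)) z)) \<in> K"
    using K(1) assms by (intro convex_sum) (auto simp: convex_cone_def step_in_K)
  then show ?thesis
    by (simp add: epoch_def scaleR_sum_right fst_sum)
qed

lemma normP2_step_le:
  assumes "w \<in> Z"
  shows "normP2 (w - (step ^^ n) z) \<le> normP2 (w - z)"
proof (induction n)
  case (Suc n)
  have "fst w \<in> K"
    using assms by (auto simp: KKT_set_def Let_def)
  from gap_step_le_normP2[OF this, of "(step ^^ n) z"] gap_nonneg[OF assms step_in_K, of "(step ^^ n) z"] Suc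
  show ?case by simp
qed simp

lemma normP2_epoch_le:
  assumes "0 < T" "w \<in> Z"
  shows "normP2 (w - epoch T z) \<le> normP2 (w - z)"
proof -
  have "real T * normP2 (w - epoch T z) \<le> (\<Sum>k<T. normP2 (w - (step ^^ (k + 1)) z))"
    by (rule normP2_mean_le[OF assms(1) epoch_def])
  also have "\<dots> \<le> (\<Sum>k<T. normP2 (w - z))"
    by (intro sum_mono normP2_step_le assms)
  finally show ?thesis
    using assms(1) by simp
qed

lemma smoothed_gap_epoch_le:
  assumes "0 < T" "0 < \<xi>" "2 * max_eigenvalue P / \<xi> \<le> real T"
  shows "smoothed_gap A b Q c K \<xi> (epoch T z) zd
     \<le> ereal (max_eigenvalue P / real T * (norm (zd - z))\<^sup>2)"
  unfolding smoothed_gap_def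
proof (rule SUP_least)
  fix w :: "'e \<times> 'y"
  assume "w \<in> K \<times> UNIV"
  then have wK: "fst w \<in> K" by auto
  define l where "l = max_eigenvalue P / real T"
  have Tl: "real T * l = max_eigenvalue P"
    using assms(1) by (simp add: l_def)
  have "0 \<le> l"
    using max_eigenvalue_P_pos by (simp add: l_def)
  moreover have "2 * max_eigenvalue P \<le> real T * \<xi>"
    using assms by (simp add: pos_divide_le_eq)
  then have "real T * (2 * l) \<le> real T * \<xi>"
    by (simp flip: Tl)
  then have "l \<le> \<xi> / 2"
    using assms(1) by simp
  ultimately have l: "0 \<le> l" "l \<le> \<xi> / 2" by blast+
  have "2 * (real T * gap A b Q c (epoch T z) w) \<le> normP2 (w - z)"
    using gap_mean_le[OF assms(1) epoch_def, of z w] sum_gap_le[OF wK, where n=T and z=z]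
      P_nonneg[of "w - (step ^^ T) z"] by linarith
  also have "\<dots> \<le> max_eigenvalue P * (norm (w - z))\<^sup>2"
    by (rule normP2_bounds)
  finally have "real T * (2 * gap A b Q c (epoch T z) w) \<le> real T * (l * (norm (w - z))\<^sup>2)"
    by (simp add: Tl[symmetric])
  then have "2 * gap A b Q c (epoch T z) w \<le> l * (norm (w - z))\<^sup>2"
    using assms(1) by simp
  \<comment> \<open>Splitting at the centre \<open>zd\<close> costs a factor 2, which cancels the 2
    in front of the gap; hence \<open>l \<le> \<xi> / 2\<close> is exactly what absorbs the
    \<open>w\<close>-part.\<close>
  also have "\<dots> \<le> l * (2 * (norm (w - zd))\<^sup>2 + 2 * (norm (zd - z))\<^sup>2)"
  proof (rule mult_left_mono[OF _ l(1)])
    have "norm (w - z) \<le> norm (w - zd) + norm (zd - z)"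
      using norm_triangle_ineq[of "w - zd" "zd - z"] by simp
    then have "(norm (w - z))\<^sup>2 \<le> (norm (w - zd) + norm (zd - z))\<^sup>2"
      by (simp add: power_mono)
    also have "\<dots> \<le> 2 * (norm (w - zd))\<^sup>2 + 2 * (norm (zd - z))\<^sup>2"
      using sum_squares_bound[of "norm (w - zd)" "norm (zd - z)"] by (simp add: power2_sum)
    finally show "(norm (w - z))\<^sup>2 \<le> 2 * (norm (w - zd))\<^sup>2 + 2 * (norm (zd - z))\<^sup>2" .
  qed
  finally have "gap A b Q c (epoch T z) w \<le> l * (norm (w - zd))\<^sup>2 + l * (norm (zd - z))\<^sup>2"
    by (simp add: algebra_simps)
  also have "\<dots> \<le> \<xi> / 2 * (norm (w - zd))\<^sup>2 + l * (norm (zd - z))\<^sup>2"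
    using l by (intro add_right_mono mult_right_mono) auto
  also have "(norm (w - zd))\<^sup>2 = (norm (fst w - fst zd))\<^sup>2 + (norm (snd w - snd zd))\<^sup>2"
    by (cases w; cases zd) (simp add: norm_Pair)
  finally show "ereal (gap A b Q c (epoch T z) w - \<xi>/2 * (norm (fst w - fst zd))\<^sup>2
      - \<xi>/2 * (norm (snd w - snd zd))\<^sup>2) \<le> ereal (max_eigenvalue P / real T * (norm (zd - z))\<^sup>2)"
    by (simp add: l_def algebra_simps)
qed

text \<open>The epoch map does not increase the \<open>P\<close>-distance to a KKT point; passing
  between the \<open>P\<close>-norm and the Euclidean norm costs the condition number.\<close>

lemma norm_epoch_diff_le:
  assumes "0 < T" "w \<in> Z"
  shows "norm (w - epoch T z) \<le> sqrt (max_eigenvalue P / min_eigenvalue P) * norm (w - z)"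
proof -
  have "min_eigenvalue P * (norm (w - epoch T z))\<^sup>2 \<le> normP2 (w - epoch T z)"
    by (rule normP2_bounds)
  also have "\<dots> \<le> normP2 (w - z)"
    by (rule normP2_epoch_le[OF assms])
  also have "\<dots> \<le> max_eigenvalue P * (norm (w - z))\<^sup>2"
    by (rule normP2_bounds)
  finally have "(norm (w - epoch T z))\<^sup>2 \<le> max_eigenvalue P / min_eigenvalue P * (norm (w - z))\<^sup>2"
    using min_eigenvalue_P_pos by (simp add: field_simps)
  then have "sqrt ((norm (w - epoch T z))\<^sup>2) \<le> sqrt (max_eigenvalue P / min_eigenvalue P * (norm (w - z))\<^sup>2)"
    by (rule real_sqrt_le_mono)
  then show ?thesis
    by (simp only: real_sqrt_mult real_sqrt_abs abs_norm_cancel)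
qed

end

section \<open>Contraction across epochs\<close>

theorem theorem2p3:
  fixes A :: "'e::euclidean_space \<Rightarrow> 'y::euclidean_space"
    and b :: 'y
    and Q :: "'e \<Rightarrow> 'e"
    and c :: 'e
    and K :: "'e set"
    and \<tau> \<sigma> R \<xi> \<alpha> d0 R0 lmin lmax \<kappa> :: real
    and T :: nat
    and z0 zbar :: "'e \<times> 'y"
    and Z :: "('e \<times> 'y) set"
  assumes A: "linear A"
    and Q: "linear Q" "adjoint Q = Q" "\<forall>x. 0 \<le> x \<bullet> Q x"
    and K: "convex_cone K" "closed K"
    and Z_def: "Z = KKT_set A b Q c K"
    and Z_nonempty: "Z \<noteq> {}"
    and steps: "0 < \<tau>" "0 < \<sigma>" "\<tau> * \<sigma> * (onorm A)\<^sup>2 < 1"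
    and T_pos: "1 \<le> T"
    and lmin_def: "lmin = min_eigenvalue (pdhg_metric A \<tau> \<sigma>)"
    and lmax_def: "lmax = max_eigenvalue (pdhg_metric A \<tau> \<sigma>)"
    and kappa_def: "\<kappa> = sqrt (lmax / lmin)"
    and d0_def: "d0 = infdist z0 Z"
    and R0_def: "R0 = (1 + \<kappa>) / (1 - exp (-1)) * d0"
    and d0_pos: "0 < d0"
    and zbar: "zbar \<in> Z"
    and pos: "0 < R" "0 < \<xi>" "0 < \<alpha>"
    and growth: "\<forall>z \<in> (K \<times> UNIV) \<inter> ball zbar R. \<forall>zs \<in> Z \<inter> ball zbar R.
                   smoothed_gap A b Q c K \<xi> z zs \<ge> ereal (\<alpha> * (infdist z Z)\<^sup>2)"
    and local_ball: "cball z0 R0 \<subseteq> ball zbar R"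
    and T_large: "real T \<ge> max (2 * lmax / \<xi>) ((exp 1)\<^sup>2 * lmax / \<alpha>)"
  shows "\<forall>n. infdist (restart_point A b Q c K \<tau> \<sigma> T z0 n) Z \<le> exp (- real n) * d0"
proof -
  interpret pdhg A b Q c K \<tau> \<sigma>
    by (rule pdhg.intro) (use A Q K steps in blast)+
  define q where "q = exp (-1 :: real)"
  have q: "0 < q" "q < 1"
    by (auto simp: q_def)
  have T: "0 < T" using T_pos by simp
  have T_bounds: "2 * lmax / \<xi> \<le> real T" "(exp 1)\<^sup>2 * lmax / \<alpha> \<le> real T"
    using T_large by simp_all
  have \<kappa>: "0 \<le> \<kappa>"
    unfolding kappa_def lmin_def lmax_def using min_eigenvalue_P_pos max_eigenvalue_P_pos by simp
  have R0: "R0 * (1 - q) = (1 + \<kappa>) * d0"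
    using q by (simp add: R0_def q_def)
  have "d0 \<le> (1 + \<kappa>) * d0"
    using d0_pos \<kappa> by (simp add: algebra_simps)
  moreover have "R0 * (1 - q) \<le> R0 * 1"
  proof (rule mult_left_mono)
    show "0 \<le> R0"
      using q d0_pos \<kappa> by (simp add: R0_def flip: q_def)
  qed (use q in simp)
  ultimately have "d0 \<le> R0" using R0 by simp
  let ?z = "restart_point A b Q c K \<tau> \<sigma> T z0"
  have restart_Suc: "?z (Suc n) = epoch T (?z n)" for n
    by (simp add: epoch_def)
  \<comment> \<open>The claim is strengthened by a displacement bound:
    \<open>R0 * (1 - q ^ n)\<close> is the partial sum of the geometric series of epoch moves
    \<open>(1 + \<kappa>) * d0 * q ^ k\<close>.\<close>
  have "norm (?z n - z0) \<le> R0 * (1 - q ^ n) \<and> infdist (?z n) Z \<le> q ^ n * d0" for n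
  proof (induction n)
    case 0
    then show ?case by (simp add: d0_def)
  next
    case (Suc n)
    define z z' where "z = ?z n" and "z' = epoch T z"
    have z'_eq: "?z (Suc n) = z'"
      by (simp only: restart_Suc z'_def z_def)
    have IH: "norm (z - z0) \<le> R0 * (1 - q ^ n)" "infdist z Z \<le> q ^ n * d0"
      using Suc by (auto simp: z_def)
    obtain w where w: "w \<in> Z" and dist_w: "infdist z Z = dist z w"
      using infdist_attains_inf[OF closed_KKT, of z] Z_nonempty unfolding Z_def by blast
    have wz: "norm (w - z) \<le> q ^ n * d0"
      using IH(2) dist_w by (simp add: dist_norm norm_minus_commute)
    have "norm (w - z') \<le> \<kappa> * norm (w - z)"
      unfolding z'_def kappa_def lmin_def lmax_def
      using T w unfolding Z_def by (rule norm_epoch_diff_le)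
    also have "\<dots> \<le> \<kappa> * (q ^ n * d0)"
      using wz \<kappa> by (rule mult_left_mono)
    \<comment> \<open>The epoch move from \<open>z\<close> to \<open>z'\<close> is estimated by
      passing through \<open>w\<close>.\<close>
    finally have "norm (z' - z0) \<le> R0 * (1 - q ^ n) + (1 + \<kappa>) * d0 * q ^ n"
      using IH(1) wz norm_triangle_ineq[of "z' - w" "w - z0"] norm_triangle_ineq[of "w - z" "z - z0"]
      by (simp add: algebra_simps norm_minus_commute)
    then have "norm (z' - z0) \<le> R0 * (1 - q ^ n) + R0 * (1 - q) * q ^ n"
      by (simp only: R0)
    then have step_z0: "norm (z' - z0) \<le> R0 * (1 - q ^ Suc n)"
      by (simp add: algebra_simps)
    \<comment> \<open>The first bound keeps \<open>z'\<close> in the closed ball; the second, from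
      \<open>d0 \<le> R0\<close>, does the same for the projection \<open>w\<close>.\<close>
    have "0 \<le> R0 * q ^ Suc n" "q ^ n * d0 \<le> R0 * q ^ n"
      using q \<open>d0 \<le> R0\<close> d0_pos by simp_all
    then have "norm (z' - z0) \<le> R0" "norm (w - z0) \<le> R0"
      using step_z0 IH(1) wz norm_triangle_ineq[of "w - z" "z - z0"] by (simp_all add: algebra_simps)
    then have "z' \<in> cball z0 R0" "w \<in> cball z0 R0"
      by (simp_all add: dist_norm norm_minus_commute)
    then have "z' \<in> ball zbar R" "w \<in> ball zbar R"
      using local_ball by blast+
    moreover have "fst z' \<in> K"
      unfolding z'_def using T by (rule epoch_in_K)
    \<comment> \<open>Growth is used at the new point \<open>z'\<close> but centred at
      \<open>w\<close>, the projection of the old point \<open>z\<close>, so that the upper bound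
      involves \<open>norm (w - z)\<close>.\<close>
    ultimately have "ereal (\<alpha> * (infdist z' Z)\<^sup>2) \<le> smoothed_gap A b Q c K \<xi> z' w"
      using growth w by (simp add: mem_Times_iff)
    also have "\<dots> \<le> ereal (lmax / real T * (norm (w - z))\<^sup>2)"
      unfolding z'_def lmax_def using T pos(2) T_bounds(1)[unfolded lmax_def]
      by (rule smoothed_gap_epoch_le)
    finally have "\<alpha> * (infdist z' Z)\<^sup>2 \<le> lmax / real T * (norm (w - z))\<^sup>2"
      by simp
    also have "\<dots> \<le> \<alpha> * q\<^sup>2 * (norm (w - z))\<^sup>2"
    proof (rule mult_right_mono)
      \<comment> \<open>The factor \<open>(exp 1)\<^sup>2\<close> in the lower bound on
        \<open>T\<close> is what becomes the squared contraction factor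
        \<open>q\<^sup>2\<close>.\<close>
      have "q * exp 1 = 1"
        by (simp add: q_def flip: exp_add)
      then have "q\<^sup>2 * (exp 1)\<^sup>2 = 1"
        by (simp flip: power_mult_distrib)
      then have "lmax = q\<^sup>2 * ((exp 1)\<^sup>2 * lmax)"
        by (simp only: mult.assoc[symmetric] mult_1)
      also have "(exp 1)\<^sup>2 * lmax \<le> real T * \<alpha>"
        using T_bounds(2) pos(3) by (simp only: pos_divide_le_eq)
      then have "q\<^sup>2 * ((exp 1)\<^sup>2 * lmax) \<le> q\<^sup>2 * (real T * \<alpha>)"
        by (rule mult_left_mono) simp
      finally have "lmax \<le> \<alpha> * q\<^sup>2 * real T"
        by (simp only: mult_ac)
      then show "lmax / real T \<le> \<alpha> * q\<^sup>2"
        using T by (simp add: pos_divide_le_eq)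
    qed simp
    finally have "(infdist z' Z)\<^sup>2 \<le> (q * norm (w - z))\<^sup>2"
      using pos(3) by (simp add: power_mult_distrib)
    then have "infdist z' Z \<le> q * norm (w - z)"
      by (rule power2_le_imp_le) (use q in simp)
    also have "\<dots> \<le> q * (q ^ n * d0)"
      using wz by (rule mult_left_mono) (use q in simp)
    also have "\<dots> = q ^ Suc n * d0"
      by simp
    finally show ?case
      unfolding z'_eq using step_z0 by blast
  qed
  then show ?thesis
    by (simp add: q_def flip: exp_of_nat_mult)
qed

end
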